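(* Consider the pricing game PADD (described in the context) with a single good, $d=1$, $X=[0,\infty)$, seller cost $c(x)=x^2$, and true buyer value function $$v(x)=\begin{cases}10x & 0\le x\le 0.81,\\ 8.1 & x>0.81.\end{cases}$$ There exists a class of pricing functions $\mathcal{P}$ with $\mathcal{P}_L\subset\mathcal{P}\subset\mathcal{P}_C$ such that, when the seller changes from the linear pricing class $\mathcal{P}_L$ to the richer class $\mathcal{P}$, at the equilibrium of PADD the seller's revenue strictly decreases and the buyer's surplus strictly increases.
   Context: Setting. $X$ is the set of feasible bundles (here quantities of the single good), $c:X\to\mathbb{R}_+$ is the seller's production cost and $v:X\to\mathbb{R}_+$ the buyer's true value function. $\mathcal{C}$ is the set of all concave, monotone non-decreasing functions $u:X\to\mathbb{R}_+$ with $u(0)=0$ (possible imitative value functions). A pricing function $p$ assigns a price $p(x)$ to each $x\in X$, with $p(0)=0$; $\mathcal{P}$ denotes the class of pricing functions available to the seller. $\mathcal{P}_L=\{p: p(x)=\rho x\text{ for some }\rho\ge 0\}$ (linear pricing), and $\mathcal{P}_C$ is the set of all monotone non-decreasing concave functions $p$ on $X$ with $p(0)=0$ (concave pricing). The game PADD. The buyer commits to an imitative value function $u\in\mathcal{C}$; the seller, knowing $u$, chooses a revenue-maximizing $p\in\mathcal{P}$ assuming the buyer best responds according to $u$; the buyer then purchases a quantity in $BR_u(p)=\arg\max_{x\in X}[u(x)-p(x)]$, ties broken in favor of the seller. Formally, a pair $(p,x)$ with $p\in\mathcal{P}$, $x\in BR_u(p)$ is a seller-optimal outcome for $u$ if $p(x)-c(x)\ge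 p'(x')-c(x')$ for all $p'\in\mathcal{P}$ and $x'\in BR_u(p')$. An equilibrium of PADD is a triple $(u^*,p^*,x^* )$ with $u^*\in\mathcal{C}$ and $(p^*,x^* )$ a seller-optimal outcome for $u^*$, which maximizes the true buyer utility $v(x)-p(x)$ over all triples $(u,p,x)$ with $u\in\mathcal{C}$ and $(p,x)$ a seller-optimal outcome for $u$ (so remaining ties are broken in favor of the buyer). At equilibrium the buyer's surplus is $v(x^* )-p^*(x^* )$ and the seller's revenue is $p^*(x^* )-c(x^* )$. *)

theory Defs
  imports "HOL-Analysis.Convex" "HOL-Library.FuncSet"
begin

abbreviation X :: "real set" where
  "X \<equiv> {0..}"

text \<open>Functions on \<open>X\<close> are represented extensionally (a fixed junk value outside \<open>X\<close>), so that
  equality of functions and inclusion of classes of functions only depend on the values on \<open>X\<close>.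
  Concavity on the closed half-line does not force continuity at \<open>0\<close>: functions with an upward jump at \<open>0\<close>
  belong to both classes of concave functions below.\<close>

definition imitative_values :: "(real \<Rightarrow> real) set" where
  "imitative_values = {u \<in> X \<rightarrow>\<^sub>E {0..}. concave_on X u \<and> mono_on X u \<and> u 0 = 0}"

definition linear_pricing :: "(real \<Rightarrow> real) set" where
  "linear_pricing = {(\<lambda>x\<in>X. \<rho> * x) | \<rho>. \<rho> \<ge> 0}"

definition concave_pricing :: "(real \<Rightarrow> real) set" where
  "concave_pricing = {p \<in> extensional X. concave_on X p \<and> mono_on X p \<and> p 0 = 0}"

definition best_response :: "(real \<Rightarrow> real) \<Rightarrow> (real \<Rightarrow> real) \<Rightarrow> real set" where
  "best_response u p = {x. is_arg_max (\<lambda>y. u y - p y) (\<lambda>y. y \<in> X) x}"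

text \<open>In both definitions below the maximum has to be attained. In particular the seller cannot use
  a pricing function against which the buyer has no best response.\<close>

definition seller_optimal ::
  "(real \<Rightarrow> real) \<Rightarrow> (real \<Rightarrow> real) set \<Rightarrow> (real \<Rightarrow> real) \<Rightarrow> (real \<Rightarrow> real) \<Rightarrow> real \<Rightarrow> bool" where
  "seller_optimal c P u p x \<longleftrightarrow>
     p \<in> P \<and> x \<in> best_response u p \<and>
     (\<forall>p'\<in>P. \<forall>x'\<in>best_response u p'. p' x' - c x' \<le> p x - c x)"

definition PADD_equilibrium ::
  "(real \<Rightarrow> real) \<Rightarrow> (real \<Rightarrow> real) \<Rightarrow> (real \<Rightarrow> real) set \<Rightarrow>
   (real \<Rightarrow> real) \<Rightarrow> (real \<Rightarrow> real) \<Rightarrow> real \<Rightarrow> bool" where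
  "PADD_equilibrium c v P u p x \<longleftrightarrow>
     u \<in> imitative_values \<and> seller_optimal c P u p x \<and>
     (\<forall>u'\<in>imitative_values. \<forall>p' x'. seller_optimal c P u' p' x' \<longrightarrow> v x' - p' x' \<le> v x - p x)"

definition revenue :: "(real \<Rightarrow> real) \<Rightarrow> (real \<Rightarrow> real) \<Rightarrow> real \<Rightarrow> real" where
  "revenue c p x = p x - c x"

definition surplus :: "(real \<Rightarrow> real) \<Rightarrow> (real \<Rightarrow> real) \<Rightarrow> real \<Rightarrow> real" where
  "surplus v p x = v x - p x"

end

(* Idea: if the buyer ends up buying x at unit price \<rho> and \<rho> < 2 x, then a slightly higher unit
   price, supporting u at some y between \<rho>/2 and x, is more profitable for the seller. Hence linear
   pricing forces \<rho> >= 2 x, so the buyer's surplus is at most v x - 2 x^2, which is maximal at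
   x = 81/100 only.

   Now add to the linear prices a flat fee of 1 for any positive quantity. The buyer imitates the value
   1 + min x (81/100) for x > 0: against it linear prices yield at most 1/4, since the jump at 0 cannot
   be extracted by them, whereas the flat fee yields 1 - (81/100)^2. The fee is below the linear payment
   2 (81/100)^2, so the buyer gains and the seller loses. *)

theory Submission
  imports Defs "HOL-Analysis.Starlike"
begin

section \<open>Supporting lines, and the linear prices an optimal seller may choose\<close>

text \<open>\<open>- f\<close> is convex, and \<open>s\<close> is its right derivative at
  \<open>x\<close>, the infimum of the difference quotients. Interiority matters: at an upward jump
  at 0 no finite slope would do.\<close>

lemma concave_on_supporting_line:
  fixes f :: "real \<Rightarrow> real"
  assumes "concave_on I f" and "x \<in> interior I"
  obtains m where "\<And>y. y \<in> I \<Longrightarrow> f y \<le> f x + m * (y - x)"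
proof -
  define s where "s = Inf ((\<lambda>t. (- f x - - f t) / (x - t)) ` ({x<..} \<inter> I))"
  have "- f x + s * (y - x) \<le> - f y" if "y \<in> I" for y
    unfolding s_def
    using convex_le_Inf_differential[of I "\<lambda>x. - f x" x y] assms that
    by (simp add: concave_on_def)
  then have "f y \<le> f x + (- s) * (y - x)" if "y \<in> I" for y
    using that by force
  then show thesis by (rule that)
qed

lemma linear_pricingI: "0 \<le> \<rho> \<Longrightarrow> (\<lambda>x\<in>X. \<rho> * x) \<in> linear_pricing"
  unfolding linear_pricing_def by blast

lemma best_response_iff:
  "x \<in> best_response u p \<longleftrightarrow> 0 \<le> x \<and> (\<forall>y\<ge>0. u y - p y \<le> u x - p x)"
  unfolding best_response_def is_arg_max_linorder by auto

lemma seller_optimal_linear_price_ge: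
  assumes u: "concave_on X u"
    and P: "linear_pricing \<subseteq> P"
    and opt: "seller_optimal (\<lambda>x. x\<^sup>2) P u (\<lambda>x\<in>X. \<rho> * x) x"
    and \<rho>: "0 \<le> \<rho>"
  shows "2 * x \<le> \<rho>"
proof (rule ccontr)
  assume "\<not> 2 * x \<le> \<rho>"
  then have less: "\<rho> < 2 * x" by simp
  have x: "0 \<le> x" and br: "u y - \<rho> * y \<le> u x - \<rho> * x" if "0 \<le> y" for y
    using opt that unfolding seller_optimal_def best_response_iff by auto
  \<comment> \<open>The midpoint of \<rho>/2 and \<open>x\<close>. As \<rho>/2 maximizes
    \<open>\<rho> * z - z\<^sup>2\<close>, the seller would gain at \<open>y\<close> even at the old
    price \<rho>.\<close>
  define y where "y = (\<rho> + 2 * x) / 4"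
  have y: "0 < y" "y < x" "\<rho> < x + y"
    using less \<rho> by (auto simp: y_def field_simps)
  obtain m where m: "\<And>z. z \<in> X \<Longrightarrow> u z \<le> u y + m * (z - y)"
    using concave_on_supporting_line[OF u, of y] y by auto
  \<comment> \<open>Preferring \<open>x\<close> to \<open>y\<close> at price \<rho> makes the rise
    of \<open>u\<close> from \<open>y\<close> to \<open>x\<close> at least the left side; the
    supporting line makes it at most the right side.\<close>
  have "\<rho> * (x - y) \<le> m * (x - y)"
    using br[of y] m[of x] y by (simp add: algebra_simps)
  then have "\<rho> \<le> m" using y by simp
  have "y \<in> best_response u (\<lambda>x\<in>X. m * x)"
    using m y by (auto simp: best_response_iff algebra_simps)
  moreover have "(\<lambda>x\<in>X. m * x) \<in> P"
    using P linear_pricingI \<rho> \<open>\<rho> \<le> m\<close> by auto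
  ultimately have "m * y - y\<^sup>2 \<le> \<rho> * x - x\<^sup>2"
    using opt y unfolding seller_optimal_def by fastforce
  moreover have "\<rho> * y \<le> m * y" using \<open>\<rho> \<le> m\<close> y by simp
  \<comment> \<open>The product is the profit at \<open>y\<close> minus the profit at
    \<open>x\<close>, both at unit price \<rho>.\<close>
  ultimately have "(x - y) * (x + y - \<rho>) \<le> 0"
    by (simp add: algebra_simps power2_eq_square)
  moreover have "0 < (x - y) * (x + y - \<rho>)" using y by simp
  ultimately show False by simp
qed

section \<open>Concave functions with a jump at 0\<close>

text \<open>One family serves for both imitative values and, with slope and cap 0, for the flat
  fees.\<close>

definition capped_linear :: "real \<Rightarrow> real \<Rightarrow> real \<Rightarrow> real \<Rightarrow> real" where
  "capped_linear J k a = (\<lambda>x\<in>X. if x = 0 then 0 else J + k * min x a)"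

lemma capped_linear_0: "capped_linear J k a 0 = 0"
  by (simp add: capped_linear_def)

lemma capped_linear_pos: "0 < x \<Longrightarrow> capped_linear J k a x = J + k * min x a"
  by (simp add: capped_linear_def)

lemma concave_on_min:
  assumes "concave_on S f" and "concave_on S g"
  shows "concave_on S (\<lambda>x. min (f x) (g x))"
  unfolding concave_on_iff
proof (intro conjI ballI allI impI)
  show "convex S" using assms by (simp add: concave_on_iff)
  fix x y and s t :: real
  assume xy: "x \<in> S" "y \<in> S" and st: "0 \<le> s" "0 \<le> t" "s + t = 1"
  have "s * min (f x) (g x) \<le> s * f x" "s * min (f x) (g x) \<le> s * g x"
    "t * min (f y) (g y) \<le> t * f y" "t * min (f y) (g y) \<le> t * g y"
    using st by (simp_all add: mult_left_mono)
  moreover have "s * f x + t * f y \<le> f (s *\<^sub>R x + t *\<^sub>R y)" "s * g x + t * g y \<le> g (s *\<^sub>R x + t *\<^sub>R y)"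
    using assms xy st by (auto simp: concave_on_iff)
  ultimately show "s * min (f x) (g x) + t * min (f y) (g y)
      \<le> min (f (s *\<^sub>R x + t *\<^sub>R y)) (g (s *\<^sub>R x + t *\<^sub>R y))"
    by linarith
qed

text \<open>Concavity survives lowering the value at 0 because 0 is an extreme point of
  \<open>X\<close>: a convex combination equal to 0 puts positive weight only on 0.\<close>

lemma concave_on_jump_at_0:
  fixes f :: "real \<Rightarrow> real"
  assumes f: "concave_on X f" and "0 \<le> f 0"
  shows "concave_on X (\<lambda>x\<in>X. if x = 0 then 0 else f x)" (is "concave_on X ?g")
  unfolding concave_on_iff
proof (intro conjI ballI allI impI)
  show "convex X" by simp
  fix x y s t :: real
  assume xy: "x \<in> X" "y \<in> X" and st: "0 \<le> s" "0 \<le> t" "s + t = 1"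
  show "s * ?g x + t * ?g y \<le> ?g (s *\<^sub>R x + t *\<^sub>R y)"
  proof (cases "s * x + t * y = 0")
    case True
    then have "s * x = 0" "t * y = 0"
      using xy st by (auto simp: add_nonneg_eq_0_iff)
    then show ?thesis using True xy by auto
  next
    case False
    have "?g x \<le> f x" "?g y \<le> f y" using \<open>0 \<le> f 0\<close> xy by auto
    then have "s * ?g x + t * ?g y \<le> s * f x + t * f y"
      using st by (intro add_mono mult_left_mono) auto
    also have "\<dots> \<le> f (s *\<^sub>R x + t *\<^sub>R y)"
      using f xy st by (auto simp: concave_on_iff)
    finally show ?thesis using False xy st by simp
  qed
qed

lemma capped_linear_concave:
  assumes "0 \<le> J" and "0 \<le> k" and "0 \<le> a"
  shows "concave_on X (capped_linear J k a)"
  unfolding capped_linear_def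
proof (rule concave_on_jump_at_0)
  show "concave_on X (\<lambda>x. J + k * min x a)"
    using assms
    by (intro concave_on_add concave_on_cmul concave_on_min)
       (auto simp: concave_on_const concave_on_ident)
qed (use assms in auto)

lemma capped_linear_mono:
  assumes "0 \<le> J" and "0 \<le> k" and "0 \<le> a"
  shows "mono_on X (capped_linear J k a)"
  using assms by (auto simp: mono_on_def capped_linear_def intro!: mult_left_mono)

lemma capped_linear_imitative:
  assumes "0 \<le> J" and "0 \<le> k" and "0 \<le> a"
  shows "capped_linear J k a \<in> imitative_values"
proof -
  have "capped_linear J k a \<in> X \<rightarrow>\<^sub>E {0..}"
    using assms by (auto simp: capped_linear_def)
  then show ?thesis
    using assms capped_linear_concave capped_linear_mono
    by (simp add: imitative_values_def capped_linear_0)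
qed

lemma capped_linear_concave_pricing:
  assumes "0 \<le> J" and "0 \<le> k" and "0 \<le> a"
  shows "capped_linear J k a \<in> concave_pricing"
  using assms capped_linear_concave capped_linear_mono
  by (simp add: concave_pricing_def capped_linear_0) (simp add: capped_linear_def)

lemma linear_pricing_subset_concave_pricing: "linear_pricing \<subseteq> concave_pricing"
proof
  fix p assume "p \<in> linear_pricing"
  then obtain \<rho> where \<rho>: "0 \<le> \<rho>" and p: "p = (\<lambda>x\<in>X. \<rho> * x)"
    by (auto simp: linear_pricing_def)
  \<comment> \<open>A linear function is the case of a jump of height 0.\<close>
  have "concave_on X (\<lambda>x\<in>X. if x = 0 then 0 else \<rho> * x)"
    using \<rho> by (intro concave_on_jump_at_0 concave_on_cmul) (auto simp: concave_on_ident)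
  moreover have "(\<lambda>x\<in>X. if x = 0 then 0 else \<rho> * x) = p"
    by (auto simp: p)
  ultimately have "concave_on X p" by argo
  then show "p \<in> concave_pricing"
    using \<rho> unfolding concave_pricing_def
    by (simp add: mono_on_def mult_left_mono p)
qed

abbreviation flat_fee :: "real \<Rightarrow> real \<Rightarrow> real" where
  "flat_fee A \<equiv> capped_linear A 0 0"

lemma flat_fee_not_linear:
  assumes "A \<noteq> 0"
  shows "flat_fee A \<notin> linear_pricing"
proof
  assume "flat_fee A \<in> linear_pricing"
  then obtain \<rho> where eq: "flat_fee A = (\<lambda>x\<in>X. \<rho> * x)"
    by (auto simp: linear_pricing_def)
  from fun_cong[OF eq, of 1] fun_cong[OF eq, of 2] assms show False
    by (simp add: capped_linear_pos)
qed

lemma flat_fee_eq_iff: "flat_fee A = flat_fee B \<longleftrightarrow> A = B"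
proof
  assume "flat_fee A = flat_fee B"
  from fun_cong[OF this, of 1] show "A = B" by (simp add: capped_linear_pos)
qed simp

section \<open>Surplus bounds for the given cost and value\<close>

context
  fixes c v :: "real \<Rightarrow> real"
  defines "c \<equiv> \<lambda>x. x\<^sup>2"
    and "v \<equiv> \<lambda>x. if x \<le> 81/100 then 10 * x else 81/10"
begin

text \<open>Up to the kink of \<open>v\<close> the difference increases strictly, its parabola
  peaking only at 5/2; beyond the kink \<open>v\<close> is constant and the cost grows. Uniqueness
  later pins down the quantity traded under linear pricing.\<close>

lemma v_minus_twice_cost_le:
  assumes "0 \<le> x"
  shows "v x - 2 * x\<^sup>2 \<le> 81/10 - 2 * (81/100)\<^sup>2"
    and "v x - 2 * x\<^sup>2 = 81/10 - 2 * (81/100)\<^sup>2 \<Longrightarrow> x = 81/100"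
proof -
  have *: "v x - 2 * x\<^sup>2 < 81/10 - 2 * (81/100)\<^sup>2" if "x \<noteq> 81/100"
  proof (cases "x < 81/100")
    case True
    then have "0 < (81/100 - x) * (10 - 2 * (81/100 + x))"
      using assms by (intro mult_pos_pos) auto
    then show ?thesis using True by (simp add: v_def power2_eq_square algebra_simps)
  next
    case False
    then have "(81/100)\<^sup>2 < x\<^sup>2" using that by (intro power_strict_mono) auto
    then show ?thesis using False that by (simp add: v_def)
  qed
  then show "v x - 2 * x\<^sup>2 = 81/10 - 2 * (81/100)\<^sup>2 \<Longrightarrow> x = 81/100" by force
  from * show "v x - 2 * x\<^sup>2 \<le> 81/10 - 2 * (81/100)\<^sup>2"
  proof (cases "x = 81/100")
    case True
    show ?thesis unfolding True by (simp add: v_def)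
  qed force
qed

text \<open>Raising the unit price is possible in every class containing the linear prices, so this
  serves both classes being compared.\<close>

lemma linear_price_outcome:
  assumes "u \<in> imitative_values" and "linear_pricing \<subseteq> P"
    and opt: "seller_optimal c P u p x" and "p \<in> linear_pricing"
  shows "0 \<le> x" and "2 * x\<^sup>2 \<le> p x"
proof -
  obtain \<rho> where \<rho>: "0 \<le> \<rho>" and p: "p = (\<lambda>x\<in>X. \<rho> * x)"
    using \<open>p \<in> linear_pricing\<close> by (auto simp: linear_pricing_def)
  show x: "0 \<le> x"
    using opt by (simp add: seller_optimal_def best_response_iff)
  have "2 * x \<le> \<rho>"
    using seller_optimal_linear_price_ge[of u P \<rho> x] assms \<rho>
    by (simp add: p c_def imitative_values_def)
  then have "2 * x * x \<le> \<rho> * x" using x by (rule mult_right_mono)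
  then show "2 * x\<^sup>2 \<le> p x" using x by (simp add: p power2_eq_square)
qed

lemma linear_price_surplus_le:
  assumes "u \<in> imitative_values" and "linear_pricing \<subseteq> P"
    and "seller_optimal c P u p x" and "p \<in> linear_pricing"
  shows "v x - p x \<le> 81/10 - 2 * (81/100)\<^sup>2"
  using linear_price_outcome[OF assms] v_minus_twice_cost_le(1)[of x] by linarith

section \<open>Equilibria under linear pricing\<close>

text \<open>The slope 81/50 is the marginal cost at 81/100. The price takes all of the imitative
  value there, and the true surplus meets the bound of
  \<open>linear_price_surplus_le\<close>.\<close>

lemma linear_equilibrium_exists:
  "PADD_equilibrium c v linear_pricing
     (capped_linear 0 (81/50) (81/100)) (\<lambda>x\<in>X. 81/50 * x) (81/100)"
  (is "PADD_equilibrium c v _ ?u ?p ?x")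
  unfolding PADD_equilibrium_def
proof (intro conjI ballI allI impI)
  show "?u \<in> imitative_values" by (rule capped_linear_imitative) auto
  have u: "?u y = 81/50 * min y (81/100)" if "0 \<le> y" for y
    using that by (simp add: capped_linear_def)
  show "seller_optimal c linear_pricing ?u ?p ?x"
    unfolding seller_optimal_def
  proof (intro conjI ballI)
    show "?p \<in> linear_pricing" by (rule linear_pricingI) simp
    show "?x \<in> best_response ?u ?p" by (simp add: best_response_iff u)
    fix p' y
    assume "p' \<in> linear_pricing" and y: "y \<in> best_response ?u p'"
    then obtain \<rho> where "0 \<le> \<rho>" and p': "p' = (\<lambda>x\<in>X. \<rho> * x)"
      by (auto simp: linear_pricing_def)
    have y0: "0 \<le> y" and "?u 0 - p' 0 \<le> ?u y - p' y"
      using y by (auto simp: best_response_iff)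
    \<comment> \<open>Buying nothing is an option, so the payment is at most the imitative
      value.\<close>
    then have "\<rho> * y \<le> 81/50 * y"
      by (simp add: p' u)
    moreover have "0 \<le> (y - 81/100)\<^sup>2" by simp
    ultimately show "p' y - c y \<le> ?p ?x - c ?x"
      using y0 by (simp add: p' c_def power2_eq_square algebra_simps)
  qed
  fix u' p' x'
  assume "u' \<in> imitative_values" and "seller_optimal c linear_pricing u' p' x'"
  then have "v x' - p' x' \<le> 81/10 - 2 * (81/100)\<^sup>2"
    by (intro linear_price_surplus_le) (auto simp: seller_optimal_def)
  then show "v x' - p' x' \<le> v ?x - ?p ?x"
    by (simp add: v_def power2_eq_square)
qed

text \<open>Every equilibrium does at least as well for the buyer as the one exhibited. This makes
  the upper bound tight and forces \<open>x = 81/100\<close>.\<close>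

lemma linear_equilibrium_outcome:
  assumes eq: "PADD_equilibrium c v linear_pricing u p x"
  shows "(81/100)\<^sup>2 \<le> revenue c p x"
    and "surplus v p x \<le> 81/10 - 2 * (81/100)\<^sup>2"
proof -
  have u: "u \<in> imitative_values" and opt: "seller_optimal c linear_pricing u p x"
    using eq by (auto simp: PADD_equilibrium_def)
  then have p: "p \<in> linear_pricing" by (simp add: seller_optimal_def)
  note out = linear_price_outcome[OF u subset_refl opt p]
  have "81/10 - 2 * (81/100)\<^sup>2 \<le> v x - p x"
  proof -
    have "v (81/100) - (\<lambda>x\<in>X. 81/50 * x) (81/100) \<le> v x - p x"
      using eq linear_equilibrium_exists unfolding PADD_equilibrium_def by blast
    then show ?thesis by (simp add: v_def power2_eq_square)
  qed
  then have x: "x = 81/100"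
    using out v_minus_twice_cost_le(1)[of x] by (intro v_minus_twice_cost_le(2)) auto
  then show "(81/100)\<^sup>2 \<le> revenue c p x"
    using out(2) unfolding x by (simp add: revenue_def c_def)
  show "surplus v p x \<le> 81/10 - 2 * (81/100)\<^sup>2"
    using linear_price_surplus_le[OF u subset_refl opt p] by (simp add: surplus_def)
qed

section \<open>Equilibria once the flat fee is available\<close>

lemma flat_fee_surplus_le:
  assumes "u \<in> imitative_values"
    and opt: "seller_optimal c (insert (flat_fee 1) linear_pricing) u p x"
  shows "v x - p x \<le> 71/10"
proof (cases "p \<in> linear_pricing")
  case True
  with assms have "v x - p x \<le> 81/10 - 2 * (81/100)\<^sup>2"
    by (intro linear_price_surplus_le) auto
  then show ?thesis by (simp add: power2_eq_square)
next
  case False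
  then have p: "p = flat_fee 1" using opt by (auto simp: seller_optimal_def)
  have "0 \<le> x" using opt by (simp add: seller_optimal_def best_response_iff)
  then show ?thesis
    by (cases "x = 0") (auto simp: p capped_linear_0 capped_linear_pos v_def)
qed

text \<open>The slope above the jump makes the buyer want at least 81/100 against the fee. Without
  it every positive quantity would be a best response, and the seller's revenue would approach 1
  without attaining it.\<close>

lemma flat_fee_equilibrium_exists:
  "PADD_equilibrium c v (insert (flat_fee 1) linear_pricing)
     (capped_linear 1 1 (81/100)) (flat_fee 1) (81/100)"
  (is "PADD_equilibrium c v ?P ?u ?p ?x")
  unfolding PADD_equilibrium_def
proof (intro conjI ballI allI impI)
  show "?u \<in> imitative_values" by (rule capped_linear_imitative) auto
  have diff: "?u y - ?p y = min y (81/100)" if "0 \<le> y" for y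
    using that by (simp add: capped_linear_def)
  show "seller_optimal c ?P ?u ?p ?x"
    unfolding seller_optimal_def
  proof (intro conjI ballI)
    show "?p \<in> ?P" by simp
    show "?x \<in> best_response ?u ?p"
      using diff by (auto simp: best_response_iff)
    fix p' y
    assume p': "p' \<in> ?P" and y: "y \<in> best_response ?u p'"
    then have y0: "0 \<le> y" and br: "\<And>z. 0 \<le> z \<Longrightarrow> ?u z - p' z \<le> ?u y - p' y"
      by (auto simp: best_response_iff)
    consider "y = 0" | "0 < y" "p' = ?p" | \<rho> where "0 < y" "p' = (\<lambda>x\<in>X. \<rho> * x)"
      using p' y0 by (force simp: linear_pricing_def)
    then show "p' y - c y \<le> ?p ?x - c ?x"
    proof cases
      case 1
      then have "p' y = 0" using p' by (auto simp: linear_pricing_def capped_linear_0)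
      then show ?thesis using 1 by (simp add: c_def capped_linear_pos power2_eq_square)
    next
      case 2
      then have "81/100 \<le> y" using br[of "81/100"] diff[of y] diff[of "81/100"] by simp
      then have "(81/100)\<^sup>2 \<le> y\<^sup>2" by (rule power_mono) simp
      then show ?thesis using 2 by (simp add: c_def capped_linear_pos)
    next
      case 3
      \<comment> \<open>The jump cancels in the comparison with \<open>y / 2\<close>, so only the slope can be extracted.\<close>
      have "\<rho> * (y / 2) \<le> min y (81/100) - min (y / 2) (81/100)"
        using br[of "y / 2"] 3 by (simp add: capped_linear_pos)
      also have "\<dots> \<le> y / 2" using 3 by (auto simp: min_def)
      finally have "\<rho> * y \<le> y" by linarith
      \<comment> \<open>A slope of 1 is small enough: \<open>y - y\<^sup>2\<close> peaks at 1/4,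
        below the fee revenue \<open>1 - (81/100)\<^sup>2\<close>.\<close>
      moreover have "0 \<le> (y - 1/2)\<^sup>2" by simp
      ultimately have "\<rho> * y - y\<^sup>2 \<le> 1/4"
        by (simp add: power2_eq_square algebra_simps)
      then show ?thesis using 3 by (simp add: c_def capped_linear_pos power2_eq_square)
    qed
  qed
  fix u' p' x'
  assume "u' \<in> imitative_values" and "seller_optimal c ?P u' p' x'"
  then have "v x' - p' x' \<le> 71/10" by (rule flat_fee_surplus_le)
  then show "v x' - p' x' \<le> v ?x - ?p ?x"
    by (simp add: v_def capped_linear_pos)
qed

text \<open>A surplus of 71/10 is out of reach for linear prices, so the fee is charged, and then
  \<open>v x\<close> must attain its maximum. The resulting lower bound on \<open>x\<close>
  suffices, since the revenue \<open>1 - x\<^sup>2\<close> falls in \<open>x\<close>.\<close>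

lemma flat_fee_equilibrium_outcome:
  assumes eq: "PADD_equilibrium c v (insert (flat_fee 1) linear_pricing) u p x"
  shows "revenue c p x \<le> 1 - (81/100)\<^sup>2"
    and "surplus v p x = 71/10"
proof -
  have u: "u \<in> imitative_values"
    and opt: "seller_optimal c (insert (flat_fee 1) linear_pricing) u p x"
    using eq by (auto simp: PADD_equilibrium_def)
  have "v (81/100) - flat_fee 1 (81/100) \<le> v x - p x"
    using eq flat_fee_equilibrium_exists unfolding PADD_equilibrium_def by blast
  then have ge: "71/10 \<le> v x - p x"
    by (simp add: v_def capped_linear_pos)
  then show "surplus v p x = 71/10"
    using flat_fee_surplus_le[OF u opt] by (simp add: surplus_def)
  have "p \<notin> linear_pricing"
  proof
    assume "p \<in> linear_pricing"
    then have "v x - p x \<le> 81/10 - 2 * (81/100)\<^sup>2"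
      using u opt by (intro linear_price_surplus_le) auto
    then show False using ge by (simp add: power2_eq_square)
  qed
  then have p: "p = flat_fee 1" using opt by (auto simp: seller_optimal_def)
  have "0 \<le> x" using opt by (simp add: seller_optimal_def best_response_iff)
  moreover have "x \<noteq> 0" using ge by (auto simp: p capped_linear_0 v_def)
  ultimately have px: "p x = 1" by (simp add: p capped_linear_pos)
  then have "81/100 \<le> x" using ge by (auto simp: v_def split: if_splits)
  then have "(81/100)\<^sup>2 \<le> x\<^sup>2" by (rule power_mono) simp
  then show "revenue c p x \<le> 1 - (81/100)\<^sup>2"
    using px by (simp add: revenue_def c_def)
qed

end

theorem proposition1:
  fixes c v :: "real \<Rightarrow> real"
  defines "c \<equiv> \<lambda>x. x\<^sup>2"
    and "v \<equiv> \<lambda>x. if x \<le> 81/100 then 10 * x else 81/10"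
  shows "\<exists>P. linear_pricing \<subset> P \<and> P \<subset> concave_pricing \<and>
    (\<exists>u p x. PADD_equilibrium c v linear_pricing u p x) \<and>
    (\<exists>u p x. PADD_equilibrium c v P u p x) \<and>
    (\<forall>u p x u' p' x'.
       PADD_equilibrium c v linear_pricing u p x \<longrightarrow>
       PADD_equilibrium c v P u' p' x' \<longrightarrow>
       revenue c p' x' < revenue c p x \<and> surplus v p x < surplus v p' x')"
proof (intro exI[of _ "insert (flat_fee 1) linear_pricing"] conjI allI impI)
  show "linear_pricing \<subset> insert (flat_fee 1) linear_pricing"
    using flat_fee_not_linear[of 1] by auto
  \<comment> \<open>Another fee shows that the inclusion in the concave class is strict.\<close>
  have "flat_fee 2 \<in> concave_pricing" "flat_fee 2 \<notin> insert (flat_fee 1) linear_pricing"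
    using capped_linear_concave_pricing flat_fee_not_linear[of 2] by (auto simp: flat_fee_eq_iff)
  then show "insert (flat_fee 1) linear_pricing \<subset> concave_pricing"
    using capped_linear_concave_pricing[of 1 0 0] linear_pricing_subset_concave_pricing by auto
  show "\<exists>u p x. PADD_equilibrium c v linear_pricing u p x"
    unfolding c_def v_def using linear_equilibrium_exists by blast
  show "\<exists>u p x. PADD_equilibrium c v (insert (flat_fee 1) linear_pricing) u p x"
    unfolding c_def v_def using flat_fee_equilibrium_exists by blast
  fix u p x u' p' x'
  assume "PADD_equilibrium c v linear_pricing u p x"
    and "PADD_equilibrium c v (insert (flat_fee 1) linear_pricing) u' p' x'"
  note lin = linear_equilibrium_outcome[OF this(1)[unfolded c_def v_def], folded c_def v_def]
    and fee = flat_fee_equilibrium_outcome[OF this(2)[unfolded c_def v_def], folded c_def v_def]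
  \<comment> \<open>Both comparisons reduce to \<open>1 < 2 * (81/100)\<^sup>2\<close>.\<close>
  show "revenue c p' x' < revenue c p x"
    using lin(1) fee(1) by (simp add: power2_eq_square)
  show "surplus v p x < surplus v p' x'"
    using lin(2) fee(2) by (simp add: power2_eq_square)
qed

end
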